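(* Let $k\geq 3$. There is no $k$-geodetic digraph with minimum out-degree at least $2$ and order $M(2,k)+2$ (where $M(2,k)=1+2+\dots+2^k$) whose in-degree sequence is $(1,1,2,\dots,2,3,3)$, i.e. exactly two vertices have in-degree $1$, exactly two have in-degree $3$, and all others have in-degree $2$.
   Context: A digraph is $k$-geodetic if for any two vertices $u,v$ there is at most one directed walk from $u$ to $v$ of length at most $k$. The in-degree sequence is the list of in-degrees in non-decreasing order. *)

theory Defs
  imports "Graph_Theory.Graph_Theory" "HOL-Library.Multiset"
begin

text \<open>
  A walk is represented by its list of arcs; the empty list is the walk of length 0 from a
  vertex to itself. In a \<open>digraph\<close> there are no parallel arcs, so a walk is determined by its
  start vertex and its arc list exactly as it is by its vertex sequence.
\<close>
definition k_geodetic :: "nat \<Rightarrow> ('a, 'b) pre_digraph \<Rightarrow> bool" where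
  "k_geodetic k G \<longleftrightarrow>
     (\<forall>u\<in>verts G. \<forall>v\<in>verts G. \<forall>p q.
        pre_digraph.awalk G u p v \<and> length p \<le> k \<and>
        pre_digraph.awalk G u q v \<and> length q \<le> k \<longrightarrow> p = q)"

text \<open>Meaningful only for a nonempty finite vertex set.\<close>
definition min_out_degree :: "('a, 'b) pre_digraph \<Rightarrow> nat" where
  "min_out_degree G = Min (out_degree G ` verts G)"

definition moore_bound :: "nat \<Rightarrow> nat \<Rightarrow> nat" where
  "moore_bound d k = (\<Sum>i\<le>k. d ^ i)"

definition in_degree_sequence :: "('a, 'b) pre_digraph \<Rightarrow> nat list" where
  "in_degree_sequence G =
     sorted_list_of_multiset (image_mset (in_degree G) (mset_set (verts G)))"

end

theory Submission
  imports Defs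
begin

text \<open>
  Counting arcs shows that all out-degrees are 2, so every vertex \<open>u\<close> misses exactly two vertices
  within distance \<open>k\<close>, its outliers. Since the ball of walks into a vertex of in-degree 3 must fit
  into the digraph, both vertices \<open>v, v'\<close> of in-degree 1 precede both vertices \<open>w, w'\<close> of in-degree 3;
  hence \<open>v\<close> and \<open>v'\<close> share both out-neighbours and, besides each other, one outlier \<open>z\<close>.

  Two vertices with a common out-neighbour have nearly equal balls around their remaining
  out-neighbours, which forces each of these, when they differ, into or just above the outliers of
  the other vertex. Applied to the third in-neighbours \<open>y, y'\<close> of \<open>w, w'\<close> this leaves two
  configurations. If \<open>y\<close> points to \<open>w\<close> and \<open>w'\<close>, then \<open>w'\<close> is an outlier of \<open>w\<close>, and the same argument
  one level further down fails. Otherwise \<open>y\<close> and \<open>y'\<close> both point to \<open>z\<close>, the outliers of \<open>z\<close> are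
  \<open>v, v'\<close>, and then \<open>w\<close> and \<open>w'\<close> both reach \<open>v\<close>, which is impossible since \<open>v\<close> has in-degree 1.
\<close>

text \<open>Entry \<open>(u, t)\<close> of the \<open>j\<close>-th power of the adjacency
  matrix.\<close>

primrec walks :: "('a \<Rightarrow> 'a set) \<Rightarrow> nat \<Rightarrow> 'a \<Rightarrow> 'a \<Rightarrow> nat" where
  "walks N 0 u t = of_bool (u = t)"
| "walks N (Suc j) u t = (\<Sum>a\<in>N u. walks N j a t)"

lemma sum_pow2: "(\<Sum>j\<le>m. 2 ^ j) = 2 ^ Suc m - (1 :: nat)"
  by (induction m) simp_all

lemma sum_of_bool_card: "finite A \<Longrightarrow> (\<Sum>x\<in>A. of_bool (P x)) = card {x \<in> A. P x}"
  by (simp add: Int_def)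

lemma card_2_obtain:
  assumes "card A = 2" "a \<in> A" obtains b where "A = {a, b}" "b \<noteq> a"
proof -
  have "card (A - {a}) = 1" using assms card.infinite by (subst card_Diff_singleton) auto
  then obtain b where "A - {a} = {b}" using card_1_singletonE by blast
  then show ?thesis using that assms by blast
qed

section \<open>Walk counts and outliers for out-degree 2 and excess 2\<close>

locale excess_two =
  fixes V :: "'a set" and N :: "'a \<Rightarrow> 'a set" and k :: nat
  assumes fin_V: "finite V"
    and N_subset: "u \<in> V \<Longrightarrow> N u \<subseteq> V"
    and card_N: "u \<in> V \<Longrightarrow> card (N u) = 2"
    and k_ge: "3 \<le> k"
    and geodetic: "u \<in> V \<Longrightarrow> t \<in> V \<Longrightarrow> (\<Sum>j\<le>k. walks N j u t) \<le> 1"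
    and card_V: "card V = 2 ^ Suc k + 1"
begin

abbreviation W :: "nat \<Rightarrow> 'a \<Rightarrow> 'a \<Rightarrow> nat" where
  "W \<equiv> walks N"

definition Nin :: "'a \<Rightarrow> 'a set" where
  "Nin t = {p \<in> V. t \<in> N p}"

definition D :: "'a \<Rightarrow> 'a \<Rightarrow> nat" where
  "D u t = (\<Sum>j\<le>k. W j u t)"

definition Out :: "'a \<Rightarrow> 'a set" where
  "Out u = {t \<in> V. D u t = 0}"

lemma N_in: "u \<in> V \<Longrightarrow> a \<in> N u \<Longrightarrow> a \<in> V"
  using N_subset by blast

lemma fin_N: "u \<in> V \<Longrightarrow> finite (N u)"
  using N_subset fin_V finite_subset by blast

lemma fin_Nin: "finite (Nin t)"
  unfolding Nin_def using fin_V by simp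

lemma fin_Out: "finite (Out t)"
  unfolding Out_def using fin_V by simp

lemma sum_N_eq: "u \<in> V \<Longrightarrow> (\<Sum>a\<in>N u. f a) = (\<Sum>a\<in>V. of_bool (a \<in> N u) * (f a :: nat))"
  using N_subset[of u] fin_V by (intro sum.mono_neutral_cong_left) auto

lemma sum_Nin_eq: "(\<Sum>p\<in>Nin t. f p) = (\<Sum>p\<in>V. of_bool (t \<in> N p) * (f p :: nat))"
  using fin_V by (intro sum.mono_neutral_cong_left) (auto simp: Nin_def)

text \<open>Splits off the last arc instead of the first: a matrix commutes with its powers.\<close>

lemma W_Suc_right:
  "u \<in> V \<Longrightarrow> t \<in> V \<Longrightarrow> W (Suc j) u t = (\<Sum>p\<in>Nin t. W j u p)"
proof (induction j arbitrary: u)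
  case 0
  then show ?case
    using fin_N[of u] fin_Nin[of t] by (auto simp: of_bool_def Nin_def)
next
  case (Suc j)
  have "W (Suc (Suc j)) u t = (\<Sum>a\<in>N u. W (Suc j) a t)" by simp
  also have "\<dots> = (\<Sum>a\<in>N u. \<Sum>p\<in>Nin t. W j a p)"
    using Suc N_in by (intro sum.cong refl) blast
  also have "\<dots> = (\<Sum>p\<in>Nin t. W (Suc j) u p)"
    by (simp add: sum.swap[of _ "N u"])
  finally show ?case .
qed

lemma sum_W_target: "u \<in> V \<Longrightarrow> (\<Sum>t\<in>V. W i u t) = 2 ^ i"
proof (induction i arbitrary: u)
  case 0
  then show ?case using fin_V by (simp add: of_bool_def)
next
  case (Suc i)
  have "(\<Sum>t\<in>V. W (Suc i) u t) = (\<Sum>a\<in>N u. \<Sum>t\<in>V. W i a t)"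
    by (simp add: sum.swap[of _ V])
  also have "\<dots> = (\<Sum>a\<in>N u. 2 ^ i)"
    using Suc N_in by (intro sum.cong refl) blast
  finally show ?case using card_N[OF Suc.prems] by simp
qed

lemma sum_W_source:
  "(\<Sum>u\<in>V. W (Suc i) u t) = (\<Sum>a\<in>V. card (Nin a) * W i a t)"
proof -
  have "(\<Sum>u\<in>V. W (Suc i) u t) = (\<Sum>u\<in>V. \<Sum>a\<in>V. of_bool (a \<in> N u) * W i a t)"
    by (intro sum.cong refl) (simp add: sum_N_eq)
  also have "\<dots> = (\<Sum>a\<in>V. \<Sum>u\<in>V. of_bool (a \<in> N u) * W i a t)"
    by (rule sum.swap)
  also have "\<dots> = (\<Sum>a\<in>V. \<Sum>u\<in>Nin a. W i a t)"
    by (simp only: sum_Nin_eq)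
  finally show ?thesis by simp
qed

lemma D_Out: "u \<in> V \<Longrightarrow> t \<in> V \<Longrightarrow> D u t = of_bool (t \<notin> Out u)"
  using geodetic[of u t] by (auto simp: D_def[symmetric] Out_def)

lemma W_le_D: "i \<le> k \<Longrightarrow> W i u t \<le> D u t"
  unfolding D_def by (rule member_le_sum) auto

lemma not_Out_iff: "t \<in> V \<Longrightarrow> t \<notin> Out u \<longleftrightarrow> (\<exists>i\<le>k. W i u t > 0)"
  unfolding Out_def D_def by auto

text \<open>Level \<open>j\<close> below \<open>u\<close> carries \<open>2 ^ j\<close> walks, in
  total \<open>2 ^ Suc k - 1\<close>, all with distinct ends; \<open>V\<close> has two more
  vertices.\<close>

lemma card_Out: assumes "u \<in> V" shows "card (Out u) = 2"
proof -
  have "(\<Sum>t\<in>V. D u t) = (\<Sum>j\<le>k. \<Sum>t\<in>V. W j u t)"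
    unfolding D_def by (rule sum.swap)
  also have "\<dots> = (\<Sum>j\<le>k. 2 ^ j)" using assms by (simp add: sum_W_target)
  finally have *: "(\<Sum>t\<in>V. D u t) + 1 = 2 ^ Suc k"
    by (simp add: sum_pow2)
  have "(\<Sum>t\<in>V. D u t) + card (Out u) = (\<Sum>t\<in>V. D u t + of_bool (t \<in> Out u))"
    using fin_V sum_of_bool_card[OF fin_V, of "\<lambda>t. t \<in> Out u"]
    by (simp only: sum.distrib) (simp add: Out_def)
  also have "\<dots> = (\<Sum>t\<in>V. 1)"
    using assms by (intro sum.cong refl) (auto simp: D_Out)
  finally show ?thesis using * card_V by simp
qed

text \<open>With \<open>A\<close> the adjacency matrix, this is the fact that \<open>A\<close> commutes with
  \<open>I + A + \<dots> + A^k\<close>.\<close>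
lemma outlier_count:
  assumes "u \<in> V" "t \<in> V"
  shows "card {a \<in> N u. t \<in> Out a} + card (Nin t) = 2 + card (Out u \<inter> Nin t)"
proof -
  \<comment> \<open>Both sums count the walks of length 1 to \<open>k + 1\<close> from
    \<open>u\<close> to \<open>t\<close>, split at the first or at the last arc.\<close>
  have "(\<Sum>a\<in>N u. D a t) = (\<Sum>j\<le>k. W (Suc j) u t)"
    unfolding D_def by (simp add: sum.swap[of _ "N u"])
  also have "\<dots> = (\<Sum>p\<in>Nin t. D u p)"
    unfolding D_def using assms by (simp only: W_Suc_right sum.swap[of _ "Nin t"])
  finally have eq: "(\<Sum>a\<in>N u. D a t) = (\<Sum>p\<in>Nin t. D u p)" .
  have "(\<Sum>a\<in>N u. D a t) + card {a \<in> N u. t \<in> Out a}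
      = (\<Sum>a\<in>N u. D a t + of_bool (t \<in> Out a))"
    using sum_of_bool_card[OF fin_N[OF assms(1)], of "\<lambda>a. t \<in> Out a"]
    by (simp only: sum.distrib)
  also have "\<dots> = (\<Sum>a\<in>N u. 1)"
    using assms N_in by (intro sum.cong refl) (auto simp: D_Out)
  finally have 1: "(\<Sum>a\<in>N u. D a t) + card {a \<in> N u. t \<in> Out a} = 2"
    using card_N assms by simp
  have "(\<Sum>p\<in>Nin t. D u p) + card (Out u \<inter> Nin t)
      = (\<Sum>p\<in>Nin t. D u p + of_bool (p \<in> Out u))"
    using sum_of_bool_card[OF fin_Nin, of "\<lambda>p. p \<in> Out u" t]
    by (simp only: sum.distrib) (simp add: Int_def conj_commute)
  also have "\<dots> = (\<Sum>p\<in>Nin t. 1)"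
    using assms by (intro sum.cong refl) (auto simp: D_Out Nin_def)
  finally have 2: "(\<Sum>p\<in>Nin t. D u p) + card (Out u \<inter> Nin t) = card (Nin t)" by simp
  show ?thesis using eq 1 2 by simp
qed

lemma outlier_ex:
  assumes "u \<in> V" "t \<in> V" "card (Nin t) < 2 + card (Out u \<inter> Nin t)"
  shows "\<exists>a\<in>N u. t \<in> Out a"
proof -
  have "card {a \<in> N u. t \<in> Out a} \<noteq> 0"
    using outlier_count[OF assms(1,2)] assms(3) by linarith
  then have "{a \<in> N u. t \<in> Out a} \<noteq> {}" by (metis card.empty)
  then show ?thesis by blast
qed

lemma W_pos_Suc: "u \<in> V \<Longrightarrow> a \<in> N u \<Longrightarrow> W i a t > 0 \<Longrightarrow> W (Suc i) u t > 0"
  using fin_N by (auto simp: sum_pos2)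

lemma W_pos_SucE:
  assumes "W (Suc i) u t > 0" obtains a where "a \<in> N u" "W i a t > 0"
proof -
  have "(\<Sum>a\<in>N u. W i a t) \<noteq> 0" using assms by simp
  then show ?thesis using that by (meson neq0_conv sum.neutral)
qed

lemma W_pos_trans:
  "u \<in> V \<Longrightarrow> W i u x > 0 \<Longrightarrow> W j x t > 0 \<Longrightarrow> W (i + j) u t > 0"
proof (induction i arbitrary: u)
  case 0
  then show ?case by (simp split: if_splits)
next
  case (Suc i)
  then obtain a where "a \<in> N u" "W i a x > 0" using W_pos_SucE by blast
  with Suc show ?case using W_pos_Suc N_in by (metis add_Suc)
qed

lemma W_one: "u \<in> V \<Longrightarrow> W (Suc 0) u t = of_bool (t \<in> N u)"
  using fin_N by (simp add: of_bool_def)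

declare walks.simps(2) [simp del]

section \<open>Short cycles and double walks excluded by geodecity\<close>

lemma length_unique:
  assumes "u \<in> V" "t \<in> V" "W i u t > 0" "W j u t > 0" "i \<le> k" "j \<le> k"
  shows "i = j"
proof (rule ccontr)
  assume "i \<noteq> j"
  have "(\<Sum>l\<in>{i,j}. W l u t) \<le> (\<Sum>l\<le>k. W l u t)"
    using assms by (intro sum_mono2) auto
  then show False using geodetic[OF assms(1,2)] assms \<open>i \<noteq> j\<close> by simp
qed

lemma first_step_unique:
  assumes "u \<in> V" "t \<in> V" "a \<in> N u" "b \<in> N u" "W i a t > 0" "W j b t > 0" "i < k" "j < k"
  shows "a = b"
proof (rule ccontr)
  assume "a \<noteq> b"
  have "i = j"
    using length_unique[of u t "Suc i" "Suc j"] W_pos_Suc assms by auto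
  have "(\<Sum>l\<in>{a,b}. W i l t) \<le> (\<Sum>l\<in>N u. W i l t)"
    using assms fin_N by (intro sum_mono2) auto
  then have "W (Suc i) u t \<ge> 2" using assms \<open>a \<noteq> b\<close> \<open>i = j\<close> by (simp add: walks.simps(2))
  then show False
    using W_le_D[of "Suc i" u t] geodetic[OF assms(1,2)] assms by (simp add: D_def)
qed

lemma W_le_one: "u \<in> V \<Longrightarrow> t \<in> V \<Longrightarrow> i \<le> k \<Longrightarrow> W i u t \<le> 1"
  using W_le_D[of i u t] geodetic[of u t] by (simp add: D_def)

lemma W_pos_1: "u \<in> V \<Longrightarrow> a \<in> N u \<Longrightarrow> W (Suc 0) u a > 0"
  by (simp add: W_one)

lemma N_not_refl: "u \<in> V \<Longrightarrow> u \<notin> N u"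
  using length_unique[of u u 0 "Suc 0"] W_pos_1[of u u] k_ge by auto

lemma N_asym: assumes "u \<in> V" "a \<in> N u" shows "u \<notin> N a"
proof
  assume "u \<in> N a"
  then have "W (Suc (Suc 0)) u u > 0" using assms N_in by (intro W_pos_Suc W_pos_1)
  then show False using length_unique[of u u 0 "Suc (Suc 0)"] assms k_ge by simp
qed

lemma no_triangle: assumes "u \<in> V" "a \<in> N u" "b \<in> N a" shows "b \<notin> N u"
proof
  assume "b \<in> N u"
  have "W (Suc (Suc 0)) u b > 0" using assms N_in by (intro W_pos_Suc W_pos_1)
  then show False
    using length_unique[of u b "Suc 0" "Suc (Suc 0)"] W_pos_1[OF assms(1) \<open>b \<in> N u\<close>]
      N_in[OF assms(1) \<open>b \<in> N u\<close>] assms(1) k_ge by simp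
qed

lemma no_quadrangle:
  assumes "u \<in> V" "a \<in> N u" "b \<in> N a" "c \<in> N b" shows "c \<notin> N u"
proof
  assume "c \<in> N u"
  have "a \<in> V" using assms N_in by blast
  then have "b \<in> V" using assms N_in by blast
  have "W (Suc (Suc (Suc 0))) u c > 0"
    using assms \<open>a \<in> V\<close> \<open>b \<in> V\<close> by (intro W_pos_Suc W_pos_1)
  then show False
    using length_unique[of u c "Suc 0" "Suc (Suc (Suc 0))"] W_pos_1[OF assms(1) \<open>c \<in> N u\<close>]
      N_in[OF assms(1) \<open>c \<in> N u\<close>] assms(1) k_ge by simp
qed

lemma no_diamond:
  assumes "u \<in> V" "a \<in> N u" "b \<in> N u" "t \<in> N a" "t \<in> N b" shows "a = b"
proof -
  have V: "a \<in> V" "b \<in> V" "t \<in> V" using assms N_in by blast+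
  then show ?thesis
    using first_step_unique[of u t a b "Suc 0" "Suc 0"] W_one assms k_ge by simp
qed

section \<open>Balls of radius k - 1 and the exchange argument\<close>

definition ball :: "'a \<Rightarrow> 'a set" where
  "ball u = {t \<in> V. \<exists>i<k. W i u t > 0}"

lemma ball_self: "u \<in> V \<Longrightarrow> u \<in> ball u"
  unfolding ball_def using k_ge by (auto intro!: exI[of _ 0])

lemma not_in_ball_N: assumes "u \<in> V" "a \<in> N u" shows "u \<notin> ball a"
proof
  assume "u \<in> ball a"
  then obtain i where "i < k" "W i a u > 0" unfolding ball_def by auto
  then show False
    using length_unique[of u u 0 "Suc i"] W_pos_Suc[of u a i u] assms by auto
qed

lemma not_self_Out: "u \<in> V \<Longrightarrow> u \<notin> Out u"
  using not_Out_iff[of u u] by (auto intro!: exI[of _ 0])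

lemma ball_Out: assumes "u \<in> V" "a \<in> N u" shows "ball a \<inter> Out u = {}"
proof -
  have "t \<notin> Out u" if "t \<in> ball a" for t
    using that not_Out_iff[of t u] W_pos_Suc[OF assms, of _ t] Suc_leI
    unfolding ball_def by blast
  then show ?thesis by blast
qed

lemma ball_cover:
  assumes "u \<in> V" "t \<in> V" "t \<noteq> u" "t \<notin> Out u"
  obtains a where "a \<in> N u" "t \<in> ball a"
proof -
  obtain i where i: "i \<le> k" "W i u t > 0" using not_Out_iff assms by blast
  with assms obtain j where j: "i = Suc j" by (cases i) auto
  with i obtain a where "a \<in> N u" "W j a t > 0" using W_pos_SucE by blast
  then show ?thesis using that i j assms Suc_le_lessD unfolding ball_def by blast
qed

text \<open>The vertex \<open>u\<close>, its outliers and the balls of its two out-neighbours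
  partition \<open>V\<close>. Two vertices sharing \<open>w\<close> thus have equal right-hand
  sides.\<close>

lemma complement_ball:
  assumes "u \<in> V" "N u = {w, s}" "w \<noteq> s"
  shows "V - ball w = insert u (Out u) \<union> ball s"
proof -
  have V: "w \<in> V" "s \<in> V" using N_in assms by blast+
  have "ball w \<inter> ball s = {}"
    using first_step_unique[of u _ w s] assms unfolding ball_def by auto
  moreover have "Out u \<subseteq> V" "ball s \<subseteq> V" unfolding Out_def ball_def by auto
  moreover have "t \<in> insert u (Out u) \<union> ball s \<union> ball w" if "t \<in> V" for t
    using ball_cover[of u t] that assms by auto
  ultimately show ?thesis
    using assms not_in_ball_N[of u w] ball_Out[of u w] by blast
qed

text \<open>The two balls around \<open>s\<close> and \<open>s'\<close> agree up to three vertices. If \<open>s'\<close> lies on level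
  \<open>j\<close> below \<open>s\<close>, then the whole level \<open>k - j\<close> below \<open>s'\<close> has left the ball of \<open>s\<close>, so it consists of
  exceptional vertices; its size \<open>2 ^ (k - j)\<close> forces \<open>j = k - 1\<close>.\<close>
lemma exchange:
  assumes u: "u \<in> V" "N u = {w, s}" "w \<noteq> s"
    and u': "u' \<in> V" "N u' = {w, s'}" "w \<noteq> s'"
  shows "s' = s \<or> s' \<in> Out u \<or> (N s' = Out u \<and> W (k - 1) s s' > 0)"
proof -
  have V: "w \<in> V" "s \<in> V" "s' \<in> V" using N_in u u' by blast+
  have eq: "insert u (Out u) \<union> ball s = insert u' (Out u') \<union> ball s'"
    using complement_ball[OF u] complement_ball[OF u'] by simp
  \<comment> \<open>Here and in the next line, a walk of length 2 or 3 from \<open>u'\<close>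
    through \<open>u\<close> to \<open>w\<close> would compete with the arc from \<open>u'\<close>
    to \<open>w\<close>.\<close>
  have "s' \<noteq> u" using no_triangle[of u' s' w] u u' by auto
  have "u \<notin> N s'" using no_quadrangle[of u' s' u w] u u' by auto
  have "s' \<in> insert u (Out u) \<union> ball s" using eq ball_self[OF V(3)] by blast
  moreover have "N s' = Out u \<and> W (k - 1) s s' > 0" if "s' \<noteq> s" "s' \<in> ball s"
  proof -
    obtain j where j: "j < k" "W j s s' > 0" using \<open>s' \<in> ball s\<close> unfolding ball_def by auto
    with \<open>s' \<noteq> s\<close> have "j \<noteq> 0" by (cases j) auto
    define L where "L = {t \<in> V. W (k - j) s' t > 0}"
    have "L \<subseteq> insert u (Out u)"
    proof
      fix t assume "t \<in> L"
      then have t: "t \<in> V" "W (k - j) s' t > 0" unfolding L_def by auto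
      then have "t \<in> ball s'"
        using \<open>j \<noteq> 0\<close> j unfolding ball_def by (auto intro!: exI[of _ "k - j"])
      moreover have "t \<notin> ball s"
      proof
        assume "t \<in> ball s"
        then obtain i where "i < k" "W i s t > 0" unfolding ball_def by auto
        moreover have "W k s t > 0" using W_pos_trans[OF V(2) j(2) t(2)] j by simp
        ultimately show False using length_unique[of s t k i] V(2) t(1) by simp
      qed
      ultimately show "t \<in> insert u (Out u)" using eq by blast
    qed
    then have "card L \<le> 3"
      using card_mono[of "insert u (Out u)" L] fin_Out card_Out[OF u(1)]
      by (simp add: card_insert_if split: if_splits)
    have "2 ^ (k - j) = (\<Sum>t\<in>V. W (k - j) s' t)" using sum_W_target V by simp
    also have "\<dots> = (\<Sum>t\<in>L. W (k - j) s' t)"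
      using fin_V by (intro sum.mono_neutral_right) (auto simp: L_def)
    also have "\<dots> \<le> (\<Sum>t\<in>L. 1)"
      using W_le_one V by (intro sum_mono) (auto simp: L_def)
    finally have "(2::nat) ^ (k - j) < 2 ^ 2" using \<open>card L \<le> 3\<close> by simp
    then have "k - j < 2" by (rule power_less_imp_less_exp[rotated]) simp
    then have "k - j = Suc 0" using j by linarith
    \<comment> \<open>The level is now \<open>N s'\<close>; as \<open>u\<close> is excluded, its two
      vertices fill \<open>Out u\<close>.\<close>
    then have "N s' \<subseteq> L" unfolding L_def using W_one[of s'] V N_in by auto
    then have "N s' \<subseteq> Out u" using \<open>L \<subseteq> _\<close> \<open>u \<notin> N s'\<close> by blast
    then have "N s' = Out u"
      using card_subset_eq[OF fin_Out] card_N V card_Out u by metis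
    moreover have "j = k - 1" using \<open>k - j = Suc 0\<close> by simp
    ultimately show ?thesis using j by blast
  qed
  ultimately show ?thesis using \<open>s' \<noteq> u\<close> by auto
qed

end

text \<open>\<open>c i\<close> stands for the walks of length \<open>i\<close> into a vertex of
  in-degree 3, \<open>d i\<close> for those among them that start at in-degree 1, where doubling
  fails. At most one is lost at level 1, so levels 0 to 2 give at least 1 + 3 + 5 = 9.\<close>

lemma growth_with_deficit:
  fixes c d :: "nat \<Rightarrow> nat"
  assumes c0: "c 0 = 1" and c1: "c 1 = 3" and rec: "\<And>i. 2 * c i \<le> c (Suc i) + d i"
    and total: "(\<Sum>i\<le>k. d i) \<le> 2" and d1: "d 1 \<le> 1" and k: "2 \<le> k"
  shows "9 * 2 ^ (k - 2) \<le> (\<Sum>i\<le>k. c i)"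
proof -
  have part: "(\<Sum>j<i. d j) \<le> 2" if "i \<le> k" for i
  proof -
    have "(\<Sum>j<i. d j) \<le> (\<Sum>j\<le>k. d j)" using that by (intro sum_mono2) auto
    with total show ?thesis by simp
  qed
  \<comment> \<open>Past deficits are added to make the induction close: doubling turns the surplus
    2 into 4, and the past deficits, at most 2, are then subtracted once.\<close>
  have pot: "9 * 2 ^ m + 2 \<le> c (m + 3) + (\<Sum>j<m + 3. d j)" if "m + 3 \<le> k" for m
    using that
  proof (induction m)
    case 0
    show ?case using rec[of 1] rec[of 2] c1 d1
      by (simp add: numeral_eq_Suc)
  next
    case (Suc m)
    then have "9 * 2 ^ m + 2 \<le> c (m + 3) + (\<Sum>j<m + 3. d j)" by simp
    moreover have "(\<Sum>j<m + 3. d j) \<le> 2" using part Suc.prems by simp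
    moreover have "(\<Sum>j<Suc m + 3. d j) = (\<Sum>j<m + 3. d j) + d (m + 3)"
      by (simp only: add_Suc sum.lessThan_Suc)
    ultimately show ?case using rec[of "m + 3"] by simp
  qed
  have "9 * 2 ^ m \<le> (\<Sum>i\<le>m + 2. c i)" if "m + 2 \<le> k" for m
    using that
  proof (induction m)
    case 0
    show ?case using rec[of 1] c0 c1 d1 by (simp add: numeral_eq_Suc)
  next
    case (Suc m)
    then have "9 * 2 ^ m \<le> (\<Sum>i\<le>m + 2. c i)" by simp
    moreover have "9 * 2 ^ m \<le> c (m + 3)"
      using pot[of m] part[of "m + 3"] Suc.prems by simp
    moreover have "(\<Sum>i\<le>Suc m + 2. c i) = (\<Sum>i\<le>m + 2. c i) + c (m + 3)"
      by (simp only: add_Suc sum.atMost_Suc) (simp add: numeral_eq_Suc)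
    ultimately show ?case by simp
  qed
  from this[of "k - 2"] k show ?thesis by (simp only: le_add_diff_inverse2 order_refl)
qed

section \<open>The in-degree sequence (1,1,2,...,2,3,3)\<close>

locale excess_two_nonregular = excess_two +
  fixes v v' w w' :: 'a
  assumes V: "v \<in> V" "v' \<in> V" "w \<in> V" "w' \<in> V"
    and v_neq: "v \<noteq> v'" and w_neq: "w \<noteq> w'"
    and card_Nin_v: "card (Nin v) = 1" and card_Nin_v': "card (Nin v') = 1"
    and card_Nin_w: "card (Nin w) = 3" and card_Nin_w': "card (Nin w') = 3"
    and card_Nin: "\<And>t. t \<in> V \<Longrightarrow> t \<notin> {v, v', w, w'} \<Longrightarrow> card (Nin t) = 2"
begin

text \<open>The hypotheses are symmetric in \<open>w\<close> and \<open>w'\<close>; interpreting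
  this supplies the mirrored facts.\<close>

lemma swap_w: "excess_two_nonregular V N k v v' w' w"
  using V v_neq w_neq card_Nin_v card_Nin_v' card_Nin_w card_Nin_w' card_Nin
  by unfold_locales auto

lemma vw_neq: "v \<noteq> w" "v \<noteq> w'" "v' \<noteq> w" "v' \<noteq> w'"
  using card_Nin_v card_Nin_v' card_Nin_w card_Nin_w' by auto

lemma card_Nin_ge: "t \<in> V \<Longrightarrow> t \<noteq> v \<Longrightarrow> t \<noteq> v' \<Longrightarrow> 2 \<le> card (Nin t)"
  using card_Nin[of t] card_Nin_w card_Nin_w' by fastforce

text \<open>If \<open>v\<close> and \<open>v'\<close> did not both precede \<open>w\<close>, the walks of length at most \<open>k\<close> into \<open>w\<close>
  would start at more than \<open>card V\<close> vertices.\<close>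
lemma v_v'_in_Nin_w: "v \<in> Nin w \<and> v' \<in> Nin w"
proof -
  define c where "c i = (\<Sum>u\<in>V. W i u w)" for i
  define d where "d i = W i v w + W i v' w" for i
  have "c 0 = 1" unfolding c_def using V fin_V by (simp add: of_bool_def)
  moreover have "c 1 = 3"
    unfolding c_def using sum_W_source[of 0 w] V fin_V card_Nin_w by simp
  moreover have "2 * c i \<le> c (Suc i) + d i" for i
  proof -
    have d: "d i = (\<Sum>a\<in>V. (of_bool (a = v) + of_bool (a = v')) * W i a w)"
      unfolding d_def using V fin_V by (simp add: sum.distrib ring_distribs)
    have "2 \<le> card (Nin a) + (of_bool (a = v) + of_bool (a = v'))" if "a \<in> V" for a
      using card_Nin_ge[OF that] card_Nin_v card_Nin_v' v_neq by auto
    then have "(\<Sum>a\<in>V. 2 * W i a w)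
        \<le> (\<Sum>a\<in>V. (card (Nin a) + (of_bool (a = v) + of_bool (a = v'))) * W i a w)"
      by (intro sum_mono mult_le_mono1)
    also have "\<dots> = c (Suc i) + d i"
      unfolding c_def sum_W_source d by (simp add: sum.distrib[symmetric] ring_distribs)
    finally show ?thesis unfolding c_def by (simp add: sum_distrib_left)
  qed
  moreover have "(\<Sum>i\<le>k. d i) \<le> 2"
    unfolding d_def using geodetic[of v w] geodetic[of v' w] V by (simp add: sum.distrib)
  moreover have "\<not> 9 * 2 ^ (k - 2) \<le> (\<Sum>i\<le>k. c i)"
  proof -
    obtain m where m: "k = m + 3" using k_ge le_Suc_ex add.commute by metis
    have "(\<Sum>i\<le>k. c i) = (\<Sum>u\<in>V. D u w)"
      unfolding c_def D_def by (rule sum.swap)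
    also have "\<dots> \<le> (\<Sum>u\<in>V. 1)"
      unfolding D_def using geodetic V by (intro sum_mono) blast
    \<comment> \<open>The right-hand side is \<open>card V\<close>; it is below the growth bound
      once \<open>2 ^ (k - 2)\<close> exceeds 1.\<close>
    finally have "(\<Sum>i\<le>k. c i) \<le> 8 * 2 ^ (k - 2) + 1"
      using card_V m by (simp add: numeral_eq_Suc)
    moreover have "(2::nat) \<le> 2 ^ (k - 2)" using m by simp
    ultimately show ?thesis by linarith
  qed
  \<comment> \<open>Only \<open>d 1 > 1\<close> escapes the bound, and it means that both
    \<open>v\<close> and \<open>v'\<close> have an arc to \<open>w\<close>.\<close>
  ultimately have "\<not> d 1 \<le> 1"
    using growth_with_deficit[of c d k] k_ge by auto
  then show ?thesis
    unfolding d_def Nin_def using V by (auto simp: W_one of_bool_def split: if_splits)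
qed

lemma v_v'_in_Nin_w': "v \<in> Nin w' \<and> v' \<in> Nin w'"
proof -
  interpret swapped: excess_two_nonregular V N k v v' w' w by (rule swap_w)
  show ?thesis by (rule swapped.v_v'_in_Nin_w)
qed

lemma N_v: "N v = {w, w'}" and N_v': "N v' = {w, w'}"
proof -
  have "{w, w'} = N u" if "u \<in> V" "{w, w'} \<subseteq> N u" for u
    using card_subset_eq[OF fin_N that(2)] that card_N w_neq by simp
  then show "N v = {w, w'}" "N v' = {w, w'}"
    using v_v'_in_Nin_w v_v'_in_Nin_w' V unfolding Nin_def by auto
qed

lemma not_N_w_v: "v \<notin> N w" "v' \<notin> N w" "v \<notin> N w'" "v' \<notin> N w'"
  using N_asym[of v] N_asym[of v'] N_v N_v' V by auto

lemma not_N_w_w: "w' \<notin> N w" "w \<notin> N w'"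
  using no_triangle[of v w w'] no_triangle[of v w' w] N_v V by auto

lemma N_w_disjoint: "N w \<inter> N w' = {}"
  using no_diamond[of v w w'] N_v V w_neq by auto

text \<open>Both sides are what the balls of the common out-neighbours \<open>w\<close> and
  \<open>w'\<close> leave of \<open>V\<close>.\<close>

lemma Out_v_insert: "insert v (Out v) = insert v' (Out v')"
proof -
  have "insert v (Out v) = V - ball w - ball w'"
    using complement_ball[of v w w'] N_v V w_neq not_in_ball_N[of v w'] ball_Out[of v w'] by blast
  also have "\<dots> = insert v' (Out v')"
    using complement_ball[of v' w w'] N_v' V w_neq not_in_ball_N[of v' w'] ball_Out[of v' w'] by blast
  finally show ?thesis .
qed

lemma Out_v_obtain:
  obtains z where "Out v = {v', z}" "Out v' = {v, z}" "z \<noteq> v" "z \<noteq> v'"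
proof -
  have "v' \<in> Out v" "v \<in> Out v'" using Out_v_insert v_neq by (metis insertE insertI1)+
  then obtain z where z: "Out v = {v', z}" "z \<noteq> v'"
    using card_2_obtain[OF card_Out[OF V(1)]] by metis
  have "z \<noteq> v" using not_self_Out[OF V(1)] z by auto
  have "Out v' = {v, z}"
    using card_2_obtain[OF card_Out[OF V(2)] \<open>v \<in> Out v'\<close>] Out_v_insert z \<open>z \<noteq> v\<close>
    by (metis insertE insertI1 insert_commute singletonD)
  then show ?thesis using that z \<open>z \<noteq> v\<close> by blast
qed

lemma third_in_neighbour:
  obtains y s where "y \<in> V" "y \<noteq> v" "y \<noteq> v'" "Nin w = {v, v', y}" "N y = {w, s}" "s \<noteq> w"
proof -
  have "card (Nin w - {v, v'}) = 1"
    using v_v'_in_Nin_w card_Nin_w v_neq fin_Nin by (simp add: card_Diff_subset)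
  then obtain y where y: "Nin w - {v, v'} = {y}" using card_1_singletonE by blast
  then have "y \<in> V" "w \<in> N y" unfolding Nin_def by auto
  then obtain s where "N y = {w, s}" "s \<noteq> w" using card_2_obtain card_N by metis
  moreover have "Nin w = {v, v', y}" "y \<noteq> v" "y \<noteq> v'" using y v_v'_in_Nin_w by blast+
  ultimately show ?thesis using that \<open>y \<in> V\<close> by blast
qed

text \<open>This is \<open>exchange\<close> with \<open>v\<close> across the shared
  \<open>w\<close>. As \<open>v'\<close> also points to \<open>w\<close>, it can be neither
  \<open>s\<close> nor an out-neighbour of \<open>s\<close>.\<close>

lemma third_in_neighbour_step:
  assumes y: "y \<in> V" "N y = {w, s}" "s \<noteq> w" and z: "Out v = {v', z}"
  shows "s = w' \<or> s = z"
proof -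
  have "s \<noteq> v'" using no_triangle[of y v' w] y N_v' by auto
  moreover have "v' \<notin> N s" using no_quadrangle[of y s v' w] y N_v' by auto
  ultimately show ?thesis using exchange[of v w w' y s] V N_v y z w_neq by auto
qed

text \<open>Such a \<open>y\<close> would have the same out-neighbours as \<open>v\<close> and
  \<open>v'\<close>, hence outliers \<open>v, v'\<close>. Counting then makes \<open>w'\<close> an
  outlier of \<open>w\<close>, and the exchange fails below \<open>w\<close>.\<close>

lemma not_common_third_in_neighbour:
  assumes y: "y \<in> V" "y \<noteq> v" "y \<noteq> v'" "N y = {w, w'}"
  shows False
proof -
  have Nin_w: "Nin w = {v, v', y}"
    using y v_v'_in_Nin_w card_Nin_w card_subset_eq[OF fin_Nin, of "{v, v', y}" w] v_neq
    by (auto simp: Nin_def)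
  have Nin_w': "Nin w' = {v, v', y}"
    using y v_v'_in_Nin_w' card_Nin_w' card_subset_eq[OF fin_Nin, of "{v, v', y}" w'] v_neq
    by (auto simp: Nin_def)
  have "insert y (Out y) = V - ball w - ball w'"
    using complement_ball[of y w w'] y w_neq not_in_ball_N[of y w'] ball_Out[of y w'] by blast
  also have "\<dots> = insert v (Out v)"
    using complement_ball[of v w w'] N_v V w_neq not_in_ball_N[of v w'] ball_Out[of v w'] by blast
  finally have "{v, v'} \<subseteq> Out y" using Out_v_insert y by auto
  then have Out_y: "Out y = {v, v'}"
    using card_subset_eq[OF fin_Out, of "{v, v'}" y] card_Out y v_neq by auto
  have w_Out: "w \<notin> Out w" "w' \<notin> Out w'" using not_self_Out V by auto
  \<comment> \<open>Two of the three in-neighbours of \<open>w\<close> are outliers of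
    \<open>y\<close>, so by \<open>outlier_count\<close> an out-neighbour of \<open>y\<close> misses
    \<open>w\<close>; likewise for \<open>w'\<close>.\<close>
  have "Out y \<inter> Nin w = {v, v'}" "Out y \<inter> Nin w' = {v, v'}"
    using Out_y Nin_w Nin_w' by auto
  then have "\<exists>a\<in>N y. w \<in> Out a" "\<exists>a\<in>N y. w' \<in> Out a"
    using outlier_ex[OF y(1)] V card_Nin_w card_Nin_w' v_neq by simp_all
  then have 1: "w \<in> Out w'" and 2: "w' \<in> Out w" using y(4) w_Out by auto
  have "\<exists>a\<in>N y. v \<in> Out a" "\<exists>a\<in>N y. v' \<in> Out a"
    using outlier_ex[OF y(1)] V card_Nin_v card_Nin_v' by simp_all
  then have 3: "v \<in> Out w \<or> v \<in> Out w'" and 4: "v' \<in> Out w \<or> v' \<in> Out w'"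
    using y(4) by auto
  \<comment> \<open>\<open>Out w'\<close> already contains \<open>w\<close>, so it has no room for
    both \<open>v\<close> and \<open>v'\<close>.\<close>
  have "\<exists>x\<in>{v, v'}. Out w = {w', x}"
  proof (rule ccontr)
    assume *: "\<not> ?thesis"
    have "x \<notin> Out w" if "x \<in> {v, v'}" for x
    proof
      assume "x \<in> Out w"
      then have "Out w = {w', x}"
        using card_subset_eq[OF fin_Out, of "{w', x}" w] card_Out[OF V(3)] 2 that vw_neq by auto
      then show False using * that by blast
    qed
    then have "{w, v, v'} \<subseteq> Out w'" using 1 3 4 by auto
    then show False
      using card_mono[OF fin_Out, of "{w, v, v'}" w'] card_Out[OF V(4)] v_neq vw_neq by auto
  qed
  then obtain x where x: "x \<in> {v, v'}" "Out w = {w', x}" by blast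
  then have N_x: "N x = {w, w'}" "x \<in> V" using N_v N_v' V by auto
  \<comment> \<open>One level down: \<open>p\<close> has a second in-neighbour \<open>g\<close>, and
    each outcome of the exchange between \<open>w\<close> and \<open>g\<close> across
    \<open>p\<close> is refuted.\<close>
  obtain p q where pq: "N w = {p, q}" "p \<noteq> q" using card_N[OF V(3)] card_2_iff by metis
  then have p: "p \<in> V" "p \<noteq> v" "p \<noteq> v'" "p \<noteq> w" "p \<noteq> w'"
    using N_in[of w p] V not_N_w_v not_N_w_w N_not_refl[of w] by auto
  then have "card (Nin p) = 2" using card_Nin by simp
  then obtain g where g: "g \<in> Nin p" "g \<noteq> w"
    by (metis card_2_iff insertCI)
  then have "g \<in> V" "p \<in> N g" unfolding Nin_def by auto
  then obtain s where s: "N g = {p, s}" "s \<noteq> p" using card_2_obtain card_N by metis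
  have g_not: "g \<noteq> v" "g \<noteq> v'" "g \<noteq> y" "g \<noteq> w'"
    using s p N_v N_v' y pq N_w_disjoint by auto
  \<comment> \<open>Otherwise \<open>w\<close> and \<open>g\<close> share both out-neighbours, which
    makes \<open>g\<close> an outlier of \<open>w\<close>, that is \<open>w'\<close> or
    \<open>x\<close>.\<close>
  have "s \<noteq> q"
  proof
    assume "s = q"
    then have "insert w (Out w) = V - ball p - ball q" "insert g (Out g) = V - ball p - ball q"
      using complement_ball[of w p q] complement_ball[of g p q] pq s \<open>g \<in> V\<close> V
        not_in_ball_N[of w q] ball_Out[of w q] not_in_ball_N[of g q] ball_Out[of g q] by blast+
    then show False using x g g_not by auto
  qed
  moreover have "s \<noteq> w'"
    using \<open>g \<in> V\<close> s Nin_w' g_not by (auto simp: Nin_def)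
  moreover have "s \<noteq> x" using no_quadrangle[of g x w p] \<open>g \<in> V\<close> s N_x pq by auto
  moreover have "N s \<noteq> {w', x}"
    using no_triangle[of s x w'] N_x N_in[of g s] \<open>g \<in> V\<close> s by auto
  ultimately show False using exchange[of w p q g s] V pq s \<open>g \<in> V\<close> x by auto
qed

text \<open>By \<open>exchange\<close> of \<open>y\<close> with \<open>v\<close>, the alternative is
  a walk of length \<open>k - 1\<close> from \<open>z\<close> to \<open>w'\<close>; preceded by
  \<open>y'\<close> it has length \<open>k\<close> and competes with the arc from \<open>y'\<close>
  to \<open>w'\<close>.\<close>

lemma w'_in_Out_y:
  assumes y: "y \<in> V" "N y = {w, z}" "z \<noteq> w" "z \<noteq> w'"
    and y': "y' \<in> V" "N y' = {w', z}"
  shows "w' \<in> Out y"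
proof (rule ccontr)
  assume "w' \<notin> Out y"
  then have "W (k - 1) z w' > 0"
    using exchange[of y w z v w'] y V N_v w_neq by auto
  then have "W (Suc (k - 1)) y' w' > 0" using W_pos_Suc[of y' z "k - 1" w'] y' by blast
  moreover have "W (Suc 0) y' w' > 0" using W_pos_1[of y' w'] y' by blast
  ultimately show False
    using length_unique[of y' w' "Suc (k - 1)" "Suc 0"] y' V k_ge by auto
qed

text \<open>As \<open>w\<close> has in-degree above 2, \<open>outlier_count\<close> needs an outlier
  of \<open>y\<close> among its in-neighbours, and \<open>y\<close> itself is none.\<close>

lemma Out_y_obtain:
  assumes y: "y \<in> V" "Nin w = {v, v', y}" "w' \<in> Out y"
  obtains x where "x \<in> {v, v'}" "Out y = {w', x}"
proof -
  have "Out y \<inter> Nin w \<noteq> {}"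
    using outlier_count[of y w] y V card_Nin_w by auto
  then obtain x where x: "x \<in> {v, v'}" "x \<in> Out y"
    using y not_self_Out by auto
  then have "Out y = {w', x}"
    using card_subset_eq[OF fin_Out, of "{w', x}" y] card_Out[OF y(1)] y vw_neq by auto
  then show ?thesis using that x by blast
qed

text \<open>By \<open>outlier_count\<close>, more outliers of \<open>y\<close> precede
  \<open>t\<close> than its in-degree exceeds 2. Since \<open>x\<close> precedes only
  \<open>w\<close> and \<open>w'\<close>, where it just balances the excess, \<open>w'\<close> must
  precede \<open>t\<close>.\<close>

lemma Out_out_neighbour:
  assumes y: "y \<in> V" "x \<in> {v, v'}" "Out y = {w', x}"
    and a: "a \<in> N y" "t \<in> Out a" "t \<notin> {v, v'}"
  shows "t \<in> N w'"
proof (rule ccontr)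
  assume "t \<notin> N w'"
  have "t \<in> V" using a unfolding Out_def by simp
  have N_x: "N x = {w, w'}" using y N_v N_v' by auto
  have "{b \<in> N y. t \<in> Out b} \<noteq> {}" using a by blast
  then have "card {b \<in> N y. t \<in> Out b} \<noteq> 0" using fin_N y by auto
  then have "card (Nin t) < 2 + card (Out y \<inter> Nin t)"
    using outlier_count[OF y(1) \<open>t \<in> V\<close>] by simp
  moreover have "Out y \<inter> Nin t \<subseteq> (if t \<in> {w, w'} then {x} else {})"
    using \<open>t \<notin> N w'\<close> N_x y unfolding Nin_def by auto
  then have "card (Out y \<inter> Nin t) \<le> of_bool (t \<in> {w, w'})"
    using card_mono[of "{x}" "Out y \<inter> Nin t"] by (cases "t \<in> {w, w'}") auto
  moreover have "card (Nin t) = 2 + of_bool (t \<in> {w, w'})"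
    using card_Nin[OF \<open>t \<in> V\<close>] a card_Nin_w card_Nin_w' by auto
  ultimately show False by linarith
qed

text \<open>If both \<open>w\<close> and \<open>z\<close> missed \<open>v\<close>, an outlier of
  \<open>y\<close> would have to precede \<open>v\<close>; neither \<open>w'\<close> nor
  \<open>x\<close> does.\<close>

lemma v_not_Out_w:
  assumes y: "y \<in> V" "x \<in> {v, v'}" "Out y = {w', x}" "N y = {w, z}" "z \<noteq> w" "v \<in> Out z"
  shows "v \<notin> Out w"
proof
  assume "v \<in> Out w"
  have "{a \<in> N y. v \<in> Out a} = {w, z}" using y \<open>v \<in> Out w\<close> by auto
  moreover have "Out y \<inter> Nin v = {}"
    using y N_v N_v' not_N_w_v vw_neq unfolding Nin_def by auto
  ultimately show False using outlier_count[of y v] y V card_Nin_v by auto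
qed

lemma impossible: False
proof -
  interpret swapped: excess_two_nonregular V N k v v' w' w by (rule swap_w)
  obtain z where z: "Out v = {v', z}" "Out v' = {v, z}" "z \<noteq> v" "z \<noteq> v'"
    using Out_v_obtain by blast
  obtain y s where y: "y \<in> V" "y \<noteq> v" "y \<noteq> v'" "Nin w = {v, v', y}" "N y = {w, s}" "s \<noteq> w"
    using third_in_neighbour by blast
  obtain y' s' where y': "y' \<in> V" "y' \<noteq> v" "y' \<noteq> v'" "Nin w' = {v, v', y'}"
      "N y' = {w', s'}" "s' \<noteq> w'"
    using swapped.third_in_neighbour by blast
  have "s \<noteq> w'" using not_common_third_in_neighbour y by blast
  then have N_y: "N y = {w, z}" "z \<noteq> w" "z \<noteq> w'" using third_in_neighbour_step y z by blast+
  have "s' \<noteq> w" using swapped.not_common_third_in_neighbour y' by blast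
  then have N_y': "N y' = {w', z}" using swapped.third_in_neighbour_step y' z by blast
  obtain x where x: "x \<in> {v, v'}" "Out y = {w', x}"
    using Out_y_obtain[OF y(1,4)] w'_in_Out_y[OF y(1) N_y y'(1) N_y'] by blast
  obtain x' where x': "x' \<in> {v, v'}" "Out y' = {w, x'}"
    using swapped.Out_y_obtain[OF y'(1,4)]
      swapped.w'_in_Out_y[OF y'(1) N_y' N_y(3,2) y(1) N_y(1)] by blast
  have "z \<in> V" using N_in y N_y by auto
  \<comment> \<open>As \<open>z\<close> follows both \<open>y\<close> and \<open>y'\<close>, any
    other outlier of \<open>z\<close> would lie in both \<open>N w'\<close> and
    \<open>N w\<close>.\<close>
  have "t \<in> {v, v'}" if "t \<in> Out z" for t
    using Out_out_neighbour[OF y(1) x, of z t] swapped.Out_out_neighbour[OF y'(1) x', of z t]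
      N_y N_y' that N_w_disjoint by auto
  then have "Out z = {v, v'}"
    using card_subset_eq[of "{v, v'}" "Out z"] card_Out[OF \<open>z \<in> V\<close>] v_neq by auto
  then have "v \<notin> Out w" "v \<notin> Out w'"
    using v_not_Out_w[OF y(1) x N_y(1,2)] swapped.v_not_Out_w[OF y'(1) x' N_y' N_y(3)] by auto
  \<comment> \<open>In-degree 1 forces one of the out-neighbours \<open>w, w'\<close> of
    \<open>v\<close> to miss \<open>v\<close>.\<close>
  then show False using outlier_ex[of v v] V card_Nin_v N_v by auto
qed

end

section \<open>From arc lists to walk counts\<close>

context digraph
begin

definition out_nbrs :: "'a \<Rightarrow> 'a set" where
  "out_nbrs u = head G ` out_arcs G u"

lemma inj_on_head: "inj_on (head G) (out_arcs G u)"
  by (auto intro!: inj_onI no_multi_arcs simp: arc_to_ends_def)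

lemma inj_on_tail: "inj_on (tail G) (in_arcs G u)"
  by (auto intro!: inj_onI no_multi_arcs simp: arc_to_ends_def)

lemma card_out_nbrs: "card (out_nbrs u) = out_degree G u"
  unfolding out_nbrs_def out_degree_def by (rule card_image[OF inj_on_head])

lemma out_nbrs_subset: "out_nbrs u \<subseteq> verts G"
  unfolding out_nbrs_def by auto

lemma card_in_nbrs: "card {p \<in> verts G. t \<in> out_nbrs p} = in_degree G t"
proof -
  have "{p \<in> verts G. t \<in> out_nbrs p} = tail G ` in_arcs G t"
    unfolding out_nbrs_def by auto
  then show ?thesis unfolding in_degree_def by (simp add: card_image[OF inj_on_tail])
qed

lemma finite_awalks_of_length: "finite {p. awalk u p t \<and> length p = j}"
  by (rule finite_subset[OF _ finite_lists_length_eq[OF finite_arcs, of j]])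
    (auto simp: awalk_def)

lemma walks_eq_card_awalks:
  "u \<in> verts G \<Longrightarrow> walks out_nbrs j u t = card {p. awalk u p t \<and> length p = j}"
proof (induction j arbitrary: u)
  case 0
  have "{p. awalk u p t \<and> length p = 0} = (if u = t then {[]} else {})"
    using 0 by (auto simp: awalk_Nil_iff)
  then show ?case by simp
next
  case (Suc j)
  let ?S = "\<lambda>e. {p. awalk (head G e) p t \<and> length p = j}"
  have "{p. awalk u p t \<and> length p = Suc j} = (\<Union>e\<in>out_arcs G u. (#) e ` ?S e)"
    by (auto simp: length_Suc_conv awalk_Cons_iff)
  also have "card \<dots> = (\<Sum>e\<in>out_arcs G u. card ((#) e ` ?S e))"
    using finite_awalks_of_length by (intro card_UN_disjoint) auto
  also have "\<dots> = (\<Sum>e\<in>out_arcs G u. walks out_nbrs j (head G e) t)"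
    using Suc.IH by (intro sum.cong refl) (simp add: card_image)
  also have "\<dots> = walks out_nbrs (Suc j) u t"
    by (simp add: walks.simps(2) out_nbrs_def sum.reindex[OF inj_on_head])
  finally show ?case by simp
qed

lemma k_geodetic_walks:
  assumes "k_geodetic k G" "u \<in> verts G" "t \<in> verts G"
  shows "(\<Sum>j\<le>k. walks out_nbrs j u t) \<le> 1"
proof -
  let ?S = "\<Union>j\<le>k. {p. awalk u p t \<and> length p = j}"
  have "(\<Sum>j\<le>k. walks out_nbrs j u t) = card ?S"
    using finite_awalks_of_length assms(2)
    by (subst card_UN_disjoint) (auto simp: walks_eq_card_awalks)
  also have "\<dots> \<le> Suc 0"
  proof (subst card_le_Suc0_iff_eq)
    show "finite ?S" using finite_awalks_of_length by auto
    show "\<forall>p\<in>?S. \<forall>q\<in>?S. p = q" using assms unfolding k_geodetic_def by blast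
  qed
  finally show ?thesis by simp
qed

lemma sum_out_degree_eq_sum_in_degree:
  "(\<Sum>u\<in>verts G. out_degree G u) = (\<Sum>u\<in>verts G. in_degree G u)"
proof -
  have "card (arcs G) = (\<Sum>u\<in>verts G. out_degree G u)"
    using sum.group[of "arcs G" "verts G" "tail G" "\<lambda>_. 1 :: nat"]
    by (simp add: out_degree_def out_arcs_def image_subset_iff)
  moreover have "card (arcs G) = (\<Sum>u\<in>verts G. in_degree G u)"
    using sum.group[of "arcs G" "verts G" "head G" "\<lambda>_. 1 :: nat"]
    by (simp add: in_degree_def in_arcs_def image_subset_iff)
  ultimately show ?thesis by simp
qed

end

section \<open>Reading the locale assumptions off the degree sequence\<close>

lemma card_fibre: "finite A \<Longrightarrow> card {x \<in> A. f x = y} = count (image_mset f (mset_set A)) y"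
  by (simp add: count_image_mset' sum.If_cases Int_def eq_commute conj_commute)

theorem theorem6:
  fixes k :: nat
  assumes "k \<ge> 3"
  shows "\<not> (\<exists>G :: ('a, 'b) pre_digraph.
    digraph G \<and>
    k_geodetic k G \<and>
    min_out_degree G \<ge> 2 \<and>
    card (verts G) = moore_bound 2 k + 2 \<and>
    in_degree_sequence G = [1, 1] @ replicate (moore_bound 2 k - 2) 2 @ [3, 3])"
proof
  assume "\<exists>G :: ('a, 'b) pre_digraph. digraph G \<and> k_geodetic k G \<and> min_out_degree G \<ge> 2 \<and>
    card (verts G) = moore_bound 2 k + 2 \<and>
    in_degree_sequence G = [1, 1] @ replicate (moore_bound 2 k - 2) 2 @ [3, 3]"
  then obtain G :: "('a, 'b) pre_digraph" where "digraph G" and geo: "k_geodetic k G"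
    and out: "min_out_degree G \<ge> 2" and order: "card (verts G) = moore_bound 2 k + 2"
    and seq: "in_degree_sequence G = [1, 1] @ replicate (moore_bound 2 k - 2) 2 @ [3, 3]"
    by blast
  interpret digraph G by fact
  have moore: "moore_bound 2 k = 2 ^ Suc k - 1" unfolding moore_bound_def by (rule sum_pow2)
  \<comment> \<open>Ensures that \<open>moore_bound 2 k - 2\<close> is not truncated.\<close>
  have "(2::nat) ^ 2 \<le> 2 ^ Suc k" using assms by (intro power_increasing) auto
  then have ge: "2 \<le> moore_bound 2 k" using moore by simp
  have degs: "image_mset (in_degree G) (mset_set (verts G))
      = {#1, 1, 3, 3#} + replicate_mset (moore_bound 2 k - 2) 2"
    using arg_cong[OF seq, of mset] unfolding in_degree_sequence_def by simp
  have out_ge: "2 \<le> out_degree G u" if "u \<in> verts G" for u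
  proof -
    have "min_out_degree G \<le> out_degree G u"
      unfolding min_out_degree_def using that by (intro Min_le) auto
    with out show ?thesis by simp
  qed
  \<comment> \<open>The entries 1, 1, 3, 3 average 2, so the mean out-degree is 2 and its lower
    bound 2 leaves no slack.\<close>
  have "(\<Sum>u\<in>verts G. out_degree G u) = (\<Sum>u\<in>verts G. 2)"
    unfolding sum_out_degree_eq_sum_in_degree sum_unfold_sum_mset[of "in_degree G"] degs
    using order ge by simp
  then have out_eq: "out_degree G u = 2" if "u \<in> verts G" for u
    using sum_mono_inv[of "\<lambda>_. 2" "verts G" "out_degree G" u] out_ge that by simp
  interpret excess_two "verts G" out_nbrs k
    using out_nbrs_subset card_out_nbrs out_eq assms k_geodetic_walks[OF geo] order moore ge
    by unfold_locales auto
  have Nin: "card (Nin t) = in_degree G t" for t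
    unfolding Nin_def by (rule card_in_nbrs)
  have "card {u \<in> verts G. in_degree G u = 1} = 2" "card {u \<in> verts G. in_degree G u = 3} = 2"
    unfolding card_fibre[OF finite_verts] degs by simp_all
  then obtain v v' w w' where v: "{u \<in> verts G. in_degree G u = 1} = {v, v'}" "v \<noteq> v'"
    and w: "{u \<in> verts G. in_degree G u = 3} = {w, w'}" "w \<noteq> w'"
    unfolding card_2_iff by blast
  have "in_degree G t \<in> {1, 2, 3}" if "t \<in> verts G" for t
  proof -
    have "in_degree G t \<in># image_mset (in_degree G) (mset_set (verts G))" using that by simp
    then show ?thesis unfolding degs by (auto split: if_splits)
  qed
  then have "in_degree G t = 2" if "t \<in> verts G" "t \<notin> {v, v', w, w'}" for t
    using that v(1) w(1) by blast
  moreover have "v \<in> verts G \<and> in_degree G v = 1" "v' \<in> verts G \<and> in_degree G v' = 1"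
    "w \<in> verts G \<and> in_degree G w = 3" "w' \<in> verts G \<and> in_degree G w' = 3"
    using v(1) w(1) by blast+
  ultimately interpret excess_two_nonregular "verts G" out_nbrs k v v' w w'
    using v(2) w(2) by unfold_locales (simp_all add: Nin)
  show False by (rule impossible)
qed

end
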